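(* Let $n>1$ be an integer. There exists a one-to-one correspondence (bijection) between the set $V/\!\sim$ of $S_n$-orbits of (admissible) states of the jealous husbands problem (HW) with $n$ couples and the set $V'$ of (admissible) states of the missionaries and cannibals problem (MC) with $n$ missionaries and $n$ cannibals.
   Context: HW problem. Let $W=\{w_1,\dots,w_n\}$ be the set of wives, $H=\{h_1,\dots,h_n\}$ the set of husbands ($h_i$ is the husband of $w_i$), and $U=W\cup H$ ($2n$ distinct people). A subset $X\subseteq U$ is safe if either $X\cap H=\emptyset$, or for every $w_i\in X$ also $h_i\in X$. A state of HW is a triple $(L,R,loc)$ with $L\subseteq U$, $R=U\setminus L$ (people on the left, resp. right bank), $loc\in\{left,right\}$ (the boat's location); it is admissible if both $L$ and $R$ are safe. Only admissible states are considered, and $V$ denotes the set of all of them (whether or not reachable). MC problem. A pair $(c,m)$ ($c$ cannibals, $m$ missionaries) of nonnegative integers is safe if $m=0$ or $c\le m$. A state of MC is a triple $((c,m),(n-c,n-m),loc)$ with $0\le c,m\le n$ and $loc\in\{left,right\}$; it is admissible if both pairs $(c,m)$ and $(n-c,n-m)$ are safe. $V'$ denotes the set of all admissible states of MC. Group action. $S_n$ is the group of permutations of $\{1,\dots,n\}$. For $X\subseteq U$ and $\pi\in S_n$ put $\pi X=\{w_{\pi(i)}\mid w_i\in X\}\cup\{h_{\pi(j)}\mid h_j\in X\}$, and $\pi(L,R,loc)=(\pi L,\pi R,loc)$; this is an action of $S_n$ on $V$. Two states are equivalent, $\sim$, iff they have the same $S_n$-orbit; $V/\!\sim$ is the set of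 orbits. *)

theory Defs
  imports "HOL-Algebra.Sym_Groups" "HOL-Algebra.Group_Action"
begin

datatype bank = Left | Right

datatype person = Wife nat | Husband nat

definition wives :: "nat \<Rightarrow> person set"
  where "wives n = Wife ` {1..n}"

definition husbands :: "nat \<Rightarrow> person set"
  where "husbands n = Husband ` {1..n}"

definition people :: "nat \<Rightarrow> person set"
  where "people n = wives n \<union> husbands n"

definition hw_safe :: "nat \<Rightarrow> person set \<Rightarrow> bool"
  where "hw_safe n X \<longleftrightarrow> X \<inter> husbands n = {} \<or> (\<forall>i. Wife i \<in> X \<longrightarrow> Husband i \<in> X)"

type_synonym hw_state = "person set \<times> person set \<times> bank"

text \<open>The admissible states, whether or not reachable from an initial state.\<close>

definition hw_states :: "nat \<Rightarrow> hw_state set"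
  where "hw_states n =
    {(L, R, loc). L \<subseteq> people n \<and> R = people n - L \<and> hw_safe n L \<and> hw_safe n R}"

definition mc_safe :: "nat \<times> nat \<Rightarrow> bool"
  where "mc_safe = (\<lambda>(c, m). m = 0 \<or> c \<le> m)"

text \<open>The first component of each pair counts cannibals, the second missionaries.\<close>

type_synonym mc_state = "(nat \<times> nat) \<times> (nat \<times> nat) \<times> bank"

definition mc_states :: "nat \<Rightarrow> mc_state set"
  where "mc_states n =
    {((c, m), (n - c, n - m), loc) | c m loc.
      c \<le> n \<and> m \<le> n \<and> mc_safe (c, m) \<and> mc_safe (n - c, n - m)}"

definition perm_people :: "(nat \<Rightarrow> nat) \<Rightarrow> person set \<Rightarrow> person set"
  where "perm_people \<pi> X =
    {Wife (\<pi> i) | i. Wife i \<in> X} \<union> {Husband (\<pi> j) | j. Husband j \<in> X}"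

definition perm_state :: "(nat \<Rightarrow> nat) \<Rightarrow> hw_state \<Rightarrow> hw_state"
  where "perm_state \<pi> = (\<lambda>(L, R, loc). (perm_people \<pi> L, perm_people \<pi> R, loc))"

text \<open>The restriction to the admissible states is needed because \<^locale>\<open>group_action\<close>
  requires extensional functions.\<close>

definition hw_action :: "nat \<Rightarrow> (nat \<Rightarrow> nat) \<Rightarrow> hw_state \<Rightarrow> hw_state"
  where "hw_action n \<pi> = (\<lambda>s \<in> hw_states n. perm_state \<pi> s)"

lemma perm_people_id [simp]: "perm_people id X = X"
proof -
  have "p \<in> perm_people id X \<longleftrightarrow> p \<in> X" for p
    by (cases p) (auto simp: perm_people_def)
  then show ?thesis by blast
qed

lemma perm_people_comp: "perm_people (\<pi> \<circ> \<rho>) X = perm_people \<pi> (perm_people \<rho> X)"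
  by (auto simp: perm_people_def)

lemma perm_people_mono: "X \<subseteq> Y \<Longrightarrow> perm_people \<pi> X \<subseteq> perm_people \<pi> Y"
  by (auto simp: perm_people_def)

lemma perm_people_Diff:
  "inj \<pi> \<Longrightarrow> perm_people \<pi> (X - Y) = perm_people \<pi> X - perm_people \<pi> Y"
  by (auto simp: perm_people_def dest: injD)

lemma perm_people_people:
  assumes "\<pi> permutes {1..n}"
  shows "perm_people \<pi> (people n) = people n"
proof -
  have "perm_people \<pi> (people n) = Wife ` \<pi> ` {1..n} \<union> Husband ` \<pi> ` {1..n}"
    by (auto simp: perm_people_def people_def wives_def husbands_def)
  also have "\<dots> = people n"
    unfolding permutes_image[OF assms] people_def wives_def husbands_def ..
  finally show ?thesis .
qed

lemma hw_safe_perm_people: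
  assumes "\<pi> permutes {1..n}" and "hw_safe n X"
  shows "hw_safe n (perm_people \<pi> X)"
  using assms(2) permutes_in_image[OF assms(1)]
  by (fastforce simp: hw_safe_def perm_people_def husbands_def)

lemma perm_state_in_hw_states:
  assumes "\<pi> permutes {1..n}" and "s \<in> hw_states n"
  shows "perm_state \<pi> s \<in> hw_states n"
proof -
  obtain L R loc where s: "s = (L, R, loc)" by (cases s)
  have "perm_people \<pi> L \<subseteq> people n"
    using perm_people_mono[of L "people n" \<pi>] assms s
    by (simp add: hw_states_def perm_people_people)
  moreover have R: "R = people n - L" and L: "hw_safe n L" "hw_safe n R"
    using assms(2) unfolding s hw_states_def by blast+
  moreover have "perm_people \<pi> R = people n - perm_people \<pi> L"
    using R permutes_inj[OF assms(1)] by (simp only: perm_people_Diff perm_people_people[OF assms(1)])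
  ultimately show ?thesis
    using hw_safe_perm_people[OF assms(1) L(1)] hw_safe_perm_people[OF assms(1) L(2)]
    by (simp add: s hw_states_def perm_state_def)
qed

lemma perm_state_id [simp]: "perm_state id s = s"
  by (cases s) (simp add: perm_state_def)

lemma perm_state_comp: "perm_state (\<pi> \<circ> \<rho>) s = perm_state \<pi> (perm_state \<rho> s)"
  by (cases s) (simp add: perm_state_def perm_people_comp)

lemma hw_action_Bij:
  assumes "\<pi> permutes {1..n}"
  shows "hw_action n \<pi> \<in> Bij (hw_states n)"
proof -
  have "bij_betw (perm_state \<pi>) (hw_states n) (hw_states n)"
    using assms permutes_inv[OF assms] permutes_inv_o[OF assms]
    by (intro bij_betw_byWitness[where f' = "perm_state (inv' \<pi>)"])
      (auto simp: perm_state_in_hw_states perm_state_comp[symmetric])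
  then have "bij_betw (hw_action n \<pi>) (hw_states n) (hw_states n)"
    unfolding hw_action_def by (simp cong: bij_betw_cong)
  then show ?thesis
    by (simp add: Bij_def hw_action_def)
qed

lemma group_action_hw_action: "group_action (sym_group n) (hw_states n) (hw_action n)"
proof -
  have "hw_action n (\<pi> \<circ> \<rho>) = compose (hw_states n) (hw_action n \<pi>) (hw_action n \<rho>)"
    if "\<rho> permutes {1..n}" for \<pi> \<rho>
    using that
    by (auto simp: hw_action_def compose_def perm_state_comp perm_state_in_hw_states fun_eq_iff)
  then have "hw_action n \<in> hom (sym_group n) (BijGroup (hw_states n))"
    by (intro homI)
      (auto simp: sym_group_carrier sym_group_mult BijGroup_def hw_action_Bij)
  then show ?thesis
    by (simp add: group_action_def group_hom_def group_hom_axioms_def sym_group_is_group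
        group_BijGroup)
qed

lemma quotient_eq_orbits:
  "hw_states n // {(s, t). s \<in> hw_states n \<and> t \<in> hw_states n \<and>
      orbit (sym_group n) (hw_action n) s = orbit (sym_group n) (hw_action n) t}
    = orbits (sym_group n) (hw_states n) (hw_action n)"
proof -
  interpret group_action "sym_group n" "hw_states n" "hw_action n"
    by (rule group_action_hw_action)
  have sub: "orbit (sym_group n) (hw_action n) s \<subseteq> hw_states n" if "s \<in> hw_states n" for s
    unfolding orbit_def using element_image[OF _ that] by blast
  have "{t. t \<in> hw_states n \<and>
      orbit (sym_group n) (hw_action n) s = orbit (sym_group n) (hw_action n) t}
    = orbit (sym_group n) (hw_action n) s" (is "?A = ?B") if s: "s \<in> hw_states n" for s
  proof
    show "?A \<subseteq> ?B" using orbit_refl by blast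
    show "?B \<subseteq> ?A"
    proof
      fix t assume t: "t \<in> ?B"
      with sub s have tV: "t \<in> hw_states n" by blast
      have "?B = orbit (sym_group n) (hw_action n) t"
      proof
        show "?B \<subseteq> orbit (sym_group n) (hw_action n) t"
        proof
          fix u assume "u \<in> ?B"
          then show "u \<in> orbit (sym_group n) (hw_action n) t"
            using orbit_trans[OF tV s _ orbit_sym[OF s tV t]] sub[OF s] by blast
        qed
        show "orbit (sym_group n) (hw_action n) t \<subseteq> ?B"
          using orbit_trans[OF s tV _ t] sub[OF tV] by blast
      qed
      with tV show "t \<in> ?A" by blast
    qed
  qed
  then show ?thesis
    by (auto simp: quotient_def orbits_def Image_def)
qed

end

(* Write A and B for the index sets of the wives and husbands on the left bank.
   Safety of the left bank means that B is empty or A \<subseteq> B; safety of the right bank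
   means that B = {1..n} or B \<subseteq> A. So a state is admissible iff B is empty, B is everything, or
   A = B, and these conditions become m = 0, m = n, c = m under c = card A, m = card B. In each of
   the three cases the cardinalities and the boat determine the state up to a permutation of the
   couples, hence the orbits are exactly the fibres of the counting map, whose range is the set of
   MC states. *)

theory Submission
  imports Defs
begin

text \<open>Coordinates for states: permuting couples becomes taking images of two index sets, so
  the rest of the argument is about subsets of \<open>{1..n}\<close>.\<close>

definition hw_state_of :: "nat \<Rightarrow> nat set \<Rightarrow> nat set \<Rightarrow> bank \<Rightarrow> hw_state"
  where "hw_state_of n A B loc =
    (Wife ` A \<union> Husband ` B, Wife ` ({1..n} - A) \<union> Husband ` ({1..n} - B), loc)"

definition admissible :: "nat \<Rightarrow> nat set \<Rightarrow> nat set \<Rightarrow> bool"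
  where "admissible n A B \<longleftrightarrow>
    A \<subseteq> {1..n} \<and> B \<subseteq> {1..n} \<and> (B = {} \<or> B = {1..n} \<or> A = B)"

lemma hw_states_eq: "hw_states n = {hw_state_of n A B loc | A B loc. admissible n A B}"
proof (intro equalityI subsetI)
  fix s assume "s \<in> hw_states n"
  then obtain L R loc where s: "s = (L, R, loc)" and L: "L \<subseteq> people n" and R: "R = people n - L"
    and safe: "hw_safe n L" "hw_safe n R"
    unfolding hw_states_def by auto
  define A where "A = {i. Wife i \<in> L}"
  define B where "B = {i. Husband i \<in> L}"
  have AB: "A \<subseteq> {1..n}" "B \<subseteq> {1..n}"
    using L by (auto simp: A_def B_def people_def wives_def husbands_def)
  have mem: "p \<in> L \<longleftrightarrow> p \<in> Wife ` A \<union> Husband ` B" for p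
    by (cases p) (auto simp: A_def B_def)
  then have L_eq: "L = Wife ` A \<union> Husband ` B" by blast
  have R_eq: "R = Wife ` ({1..n} - A) \<union> Husband ` ({1..n} - B)"
    unfolding R L_eq people_def wives_def husbands_def by auto
  have "B = {} \<or> A \<subseteq> B"
    using safe(1) AB unfolding L_eq hw_safe_def husbands_def by blast
  \<comment> \<open>The right bank is described by complements, so its inclusion reverses to
    \<open>B\<close> \<subseteq> \<open>A\<close>; together with the left bank's \<open>A\<close>
    \<subseteq> \<open>B\<close> this forces \<open>A = B\<close>.\<close>
  moreover have "B = {1..n} \<or> {1..n} - A \<subseteq> {1..n} - B"
    using safe(2) AB unfolding R_eq hw_safe_def husbands_def by blast
  ultimately have "admissible n A B"
    using AB unfolding admissible_def by blast
  then show "s \<in> {hw_state_of n A B loc | A B loc. admissible n A B}"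
    using s L_eq R_eq unfolding hw_state_of_def by blast
next
  fix s assume "s \<in> {hw_state_of n A B loc | A B loc. admissible n A B}"
  then obtain A B loc where "s = hw_state_of n A B loc" "admissible n A B" by blast
  then show "s \<in> hw_states n"
    unfolding hw_state_of_def hw_states_def admissible_def hw_safe_def
      people_def wives_def husbands_def
    by auto
qed

lemma perm_people_image:
  "perm_people \<pi> (Wife ` A \<union> Husband ` B) = Wife ` \<pi> ` A \<union> Husband ` \<pi> ` B"
  by (auto simp: perm_people_def)

lemma perm_state_hw_state_of:
  assumes "\<pi> permutes {1..n}"
  shows "perm_state \<pi> (hw_state_of n A B loc) = hw_state_of n (\<pi> ` A) (\<pi> ` B) loc"
  unfolding hw_state_of_def perm_state_def
  by (simp only: perm_people_image image_set_diff[OF permutes_inj[OF assms]]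
      permutes_image[OF assms] prod.case)

text \<open>By finiteness the complements of \<open>A\<close> and \<open>A'\<close> also have equal
  size, so a bijection between the sets can be glued to one between the complements.\<close>

lemma ex_permutes_image_eq:
  assumes "finite S" "A \<subseteq> S" "A' \<subseteq> S" "card A = card A'"
  shows "\<exists>\<pi>. \<pi> permutes S \<and> \<pi> ` A = A'"
proof -
  have fin: "finite A" "finite A'" using assms finite_subset by blast+
  obtain f where f: "bij_betw f A A'"
    using finite_same_card_bij[OF fin assms(4)] by blast
  have "card (S - A) = card (S - A')"
    using assms fin by (simp add: card_Diff_subset)
  then obtain g where g: "bij_betw g (S - A) (S - A')"
    using finite_same_card_bij[of "S - A" "S - A'"] assms(1) by auto
  \<comment> \<open>Outside \<open>S\<close> the glued map is the identity, as
    \<open>permutes\<close> demands.\<close>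
  define \<pi> where "\<pi> x = (if x \<in> A then f x else if x \<in> S then g x else x)" for x
  have 1: "bij_betw \<pi> A A'" using f by (simp add: \<pi>_def cong: bij_betw_cong)
  have 2: "bij_betw \<pi> (S - A) (S - A')" using g by (rule bij_betw_cong[THEN iffD1, rotated]) (auto simp: \<pi>_def)
  have "bij_betw \<pi> S S"
    using bij_betw_combine[OF 1 2] assms by (simp add: Un_absorb1)
  then have "\<pi> permutes S"
    using assms(2) by (intro bij_imp_permutes) (auto simp: \<pi>_def)
  then show ?thesis using 1 by (auto simp: bij_betw_def)
qed

text \<open>One permutation has to move both sets. Any one carrying \<open>A\<close> to
  \<open>A'\<close> will do: the empty set and \<open>{1..n}\<close> are invariant, and on the
  diagonal \<open>B\<close> moves along with \<open>A\<close>.\<close>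

lemma admissible_conjugate:
  assumes adm: "admissible n A B" "admissible n A' B'"
    and card: "card A = card A'" "card B = card B'"
  shows "\<exists>\<pi>. \<pi> permutes {1..n} \<and> \<pi> ` A = A' \<and> \<pi> ` B = B'"
proof -
  have sub: "A \<subseteq> {1..n}" "B \<subseteq> {1..n}" "A' \<subseteq> {1..n}" "B' \<subseteq> {1..n}"
    using adm by (auto simp: admissible_def)
  note fin = finite_subset[OF sub(1)] finite_subset[OF sub(2)]
    finite_subset[OF sub(3)] finite_subset[OF sub(4)]
  obtain \<pi> where \<pi>: "\<pi> permutes {1..n}" "\<pi> ` A = A'"
    using ex_permutes_image_eq[of "{1..n}" A A'] sub card by auto
  \<comment> \<open>Cardinality detects whether a subset of \<open>{1..n}\<close> is empty or full,
    so both states fall under the same case.\<close>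
  have "B = {} \<and> B' = {} \<or> B = {1..n} \<and> B' = {1..n} \<or> A = B \<and> A' = B'"
  proof -
    have "B = {} \<longleftrightarrow> B' = {}" using card fin by (metis card_0_eq finite_atLeastAtMost)
    moreover have "B = {1..n} \<longleftrightarrow> B' = {1..n}"
      using card sub by (metis card_subset_eq finite_atLeastAtMost)
    ultimately show ?thesis using adm by (auto simp: admissible_def)
  qed
  then have "\<pi> ` B = B'" using \<pi> permutes_image[OF \<pi>(1)] by auto
  then show ?thesis using \<pi> by blast
qed

text \<open>Wives play the cannibals and husbands the missionaries.\<close>

definition mc_of_hw :: "hw_state \<Rightarrow> mc_state"
  where "mc_of_hw = (\<lambda>(L, R, loc).
    ((card {i. Wife i \<in> L}, card {i. Husband i \<in> L}),
     (card {i. Wife i \<in> R}, card {i. Husband i \<in> R}), loc))"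

lemma mc_of_hw_state_of:
  assumes "A \<subseteq> {1..n}" "B \<subseteq> {1..n}"
  shows "mc_of_hw (hw_state_of n A B loc)
    = ((card A, card B), (n - card A, n - card B), loc)"
proof -
  have W: "{i. Wife i \<in> Wife ` X \<union> Husband ` Y} = X"
    and H: "{i. Husband i \<in> Wife ` X \<union> Husband ` Y} = Y" for X Y
    by auto
  have "finite A" "finite B" using assms finite_subset by blast+
  then show ?thesis
    unfolding mc_of_hw_def hw_state_of_def
    using assms by (simp add: W H card_Diff_subset del: Un_iff)
qed

text \<open>Permutations are injective and so preserve the counts; conversely, equal counts give a
  common permutation by \<open>admissible_conjugate\<close>.\<close>

lemma orbit_hw_action_eq:
  assumes s: "s \<in> hw_states n"
  shows "orbit (sym_group n) (hw_action n) s = {t \<in> hw_states n. mc_of_hw t = mc_of_hw s}"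
proof -
  have orbit: "orbit (sym_group n) (hw_action n) s = {perm_state \<pi> s | \<pi>. \<pi> permutes {1..n}}"
    using s by (simp add: orbit_def sym_group_carrier hw_action_def)
  obtain A B loc where s_eq: "s = hw_state_of n A B loc" and adm: "admissible n A B"
    using s unfolding hw_states_eq by blast
  have sub: "A \<subseteq> {1..n}" "B \<subseteq> {1..n}" using adm by (auto simp: admissible_def)
  show ?thesis
    unfolding orbit
  proof (intro equalityI subsetI)
    fix t assume "t \<in> {perm_state \<pi> s | \<pi>. \<pi> permutes {1..n}}"
    then obtain \<pi> where \<pi>: "\<pi> permutes {1..n}" and t: "t = perm_state \<pi> s" by blast
    have "\<pi> ` A \<subseteq> {1..n}" "\<pi> ` B \<subseteq> {1..n}"
      using sub permutes_image[OF \<pi>] by blast+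
    moreover have "card (\<pi> ` X) = card X" for X
      using permutes_inj_on[OF \<pi>] by (rule card_image)
    ultimately have "mc_of_hw t = mc_of_hw s"
      unfolding t s_eq perm_state_hw_state_of[OF \<pi>] using sub by (simp add: mc_of_hw_state_of)
    then show "t \<in> {t \<in> hw_states n. mc_of_hw t = mc_of_hw s}"
      using perm_state_in_hw_states[OF \<pi> s] t by simp
  next
    fix t assume "t \<in> {t \<in> hw_states n. mc_of_hw t = mc_of_hw s}"
    then obtain A' B' loc' where t: "t = hw_state_of n A' B' loc'" and adm': "admissible n A' B'"
      and eq: "mc_of_hw t = mc_of_hw s"
      unfolding hw_states_eq by blast
    have "A' \<subseteq> {1..n}" "B' \<subseteq> {1..n}" using adm' by (auto simp: admissible_def)
    then have card: "card A = card A'" "card B = card B'" and loc: "loc' = loc"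
      using eq sub unfolding t s_eq by (simp_all add: mc_of_hw_state_of)
    then obtain \<pi> where \<pi>: "\<pi> permutes {1..n}" "\<pi> ` A = A'" "\<pi> ` B = B'"
      using admissible_conjugate[OF adm adm'] by blast
    then have "t = perm_state \<pi> s"
      unfolding t s_eq perm_state_hw_state_of[OF \<pi>(1)] loc by simp
    then show "t \<in> {perm_state \<pi> s | \<pi>. \<pi> permutes {1..n}}" using \<pi> by blast
  qed
qed

lemma mc_of_hw_image: "mc_of_hw ` hw_states n = mc_states n"
proof (intro equalityI subsetI)
  fix y assume "y \<in> mc_of_hw ` hw_states n"
  then obtain A B loc where adm: "admissible n A B" and y: "y = mc_of_hw (hw_state_of n A B loc)"
    unfolding hw_states_eq by blast
  have sub: "A \<subseteq> {1..n}" "B \<subseteq> {1..n}" using adm by (auto simp: admissible_def)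
  have "card A \<le> n" "card B \<le> n"
    using sub[THEN card_mono[rotated]] by auto
  moreover have "card B = 0 \<or> card B = n \<or> card A = card B"
    using adm unfolding admissible_def by auto
  ultimately show "y \<in> mc_states n"
    unfolding y mc_of_hw_state_of[OF sub] mc_states_def mc_safe_def by auto
next
  fix y assume "y \<in> mc_states n"
  then obtain c m loc where y: "y = ((c, m), (n - c, n - m), loc)" and le: "c \<le> n" "m \<le> n"
    and safe: "mc_safe (c, m)" "mc_safe (n - c, n - m)"
    unfolding mc_states_def by blast
  have "m = 0 \<or> m = n \<or> c = m"
    using safe le by (auto simp: mc_safe_def)
  \<comment> \<open>Initial segments realise the counts and turn the three numerical cases into the
    three set cases; in particular they coincide when \<open>c = m\<close>.\<close>
  then have adm: "admissible n {1..c} {1..m}"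
    using le by (auto simp: admissible_def)
  have "y = mc_of_hw (hw_state_of n {1..c} {1..m} loc)"
    using le by (simp add: y mc_of_hw_state_of)
  then show "y \<in> mc_of_hw ` hw_states n"
    using adm unfolding hw_states_eq by blast
qed

text \<open>Over points of the image the fibres are nonempty, so distinct values have distinct
  fibres. The target is indexed by points of \<open>X\<close> to match the form of a set of
  orbits.\<close>

lemma bij_betw_fibres: "bij_betw (\<lambda>y. {x \<in> X. f x = y}) (f ` X) ((\<lambda>z. {x \<in> X. f x = f z}) ` X)"
  by (rule bij_betw_imageI) (auto simp: inj_on_def)

theorem theorem1:
  fixes n :: nat
  assumes "n > 1"
  shows "\<exists>f. bij_betw f (orbits (sym_group n) (hw_states n) (hw_action n)) (mc_states n)"
proof -
  have "orbits (sym_group n) (hw_states n) (hw_action n)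
      = (\<lambda>s. {t \<in> hw_states n. mc_of_hw t = mc_of_hw s}) ` hw_states n"
    unfolding orbits_def Setcompr_eq_image by (rule image_cong) (simp_all add: orbit_hw_action_eq)
  then show ?thesis
    \<comment> \<open>The fibre map runs from MC states to orbits, hence the inverse.\<close>
    using bij_betw_inv[OF bij_betw_fibres[of "hw_states n" mc_of_hw]]
    by (simp add: mc_of_hw_image)
qed

end
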